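(* Let $X$ be a topological space and let $g,h\in H_2(X)$ be invertible continuous binary operations of $X$. If $(g,h)$ is a distributive pair, then $(g,h^{-1})$, $(g^{-1},h)$ and $(g^{-1},h^{-1})$ are also distributive pairs.
   Context: For a topological space $X$, $C_2(X)$ denotes the set of all continuous binary operations $f:X^2\to X$. It is a monoid under the operation $(f\varphi)(x,y)=f(x,\varphi(x,y))$, with identity element $e(x,y)=y$. $H_2(X)$ denotes the group of all invertible elements of the monoid $C_2(X)$; inverses $g^{-1}$ are taken in this group. An ordered pair $(g,h)$ of elements of $H_2(X)$ is called a distributive pair if $g(x,h(y,z))=h(g(x,y),g(x,z))$ for all $x,y,z\in X$. *)

theory Defs
  imports "HOL-Analysis.Analysis" "HOL-Algebra.Group"
begin

text \<open>
  A space is an abstract \<^typ>\<open>'a topology\<close>, so the empty space is included. Its binary operations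
  are represented by functions that are \<^const>\<open>extensional\<close> on
  \<open>topspace X \<times> topspace X\<close>: equality in HOL is then equality of operations on
  the space, which makes the identity and the inverses of the monoid unique.
\<close>

definition C2 :: "'a topology \<Rightarrow> ('a \<times> 'a \<Rightarrow> 'a) monoid" where
  "C2 X =
    \<lparr>carrier = {f \<in> extensional (topspace X \<times> topspace X).
                  continuous_map (prod_topology X X) X f},
     monoid.mult = (\<lambda>f \<phi>. \<lambda>(x, y)\<in>topspace X \<times> topspace X. f (x, \<phi> (x, y))),
     one = (\<lambda>(x, y)\<in>topspace X \<times> topspace X. y)\<rparr>"

definition H2 :: "'a topology \<Rightarrow> ('a \<times> 'a \<Rightarrow> 'a) monoid" where
  "H2 X = units_of (C2 X)"

definition distributive_pair ::
    "'a topology \<Rightarrow> ('a \<times> 'a \<Rightarrow> 'a) \<Rightarrow> ('a \<times> 'a \<Rightarrow> 'a) \<Rightarrow> bool" where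
  "distributive_pair X g h \<longleftrightarrow>
     g \<in> carrier (H2 X) \<and> h \<in> carrier (H2 X) \<and>
     (\<forall>x\<in>topspace X. \<forall>y\<in>topspace X. \<forall>z\<in>topspace X.
        g (x, h (y, z)) = h (g (x, y), g (x, z)))"

lemma C2_closed:
  assumes "f \<in> carrier (C2 X)" "x \<in> topspace X" "y \<in> topspace X"
  shows "f (x, y) \<in> topspace X"
  using assms by (auto simp: C2_def continuous_map_def Pi_iff)

lemma monoid_C2: "monoid (C2 X)"
proof (rule monoidI)
  fix f k assume f: "f \<in> carrier (C2 X)" and k: "k \<in> carrier (C2 X)"
  have cf: "continuous_map (prod_topology X X) X f"
    and ck: "continuous_map (prod_topology X X) X k"
    using f k by (auto simp: C2_def)
  have "continuous_map (prod_topology X X) (prod_topology X X) (\<lambda>p. (fst p, k p))"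
    using ck by (intro continuous_map_pairedI continuous_map_fst)
  from continuous_map_compose[OF this cf]
  have "continuous_map (prod_topology X X) X (\<lambda>p. f (fst p, k p))"
    by (simp add: o_def)
  then have "continuous_map (prod_topology X X) X
      (\<lambda>(x, y)\<in>topspace X \<times> topspace X. f (x, k (x, y)))"
    by (rule continuous_map_eq) auto
  then show "f \<otimes>\<^bsub>C2 X\<^esub> k \<in> carrier (C2 X)"
    by (simp add: C2_def)
next
  have "continuous_map (prod_topology X X) X (\<lambda>(x, y)\<in>topspace X \<times> topspace X. y)"
    by (rule continuous_map_eq[OF continuous_map_snd]) auto
  then show "\<one>\<^bsub>C2 X\<^esub> \<in> carrier (C2 X)"
    by (simp add: C2_def)
next
  fix f k l assume "f \<in> carrier (C2 X)" "k \<in> carrier (C2 X)" "l \<in> carrier (C2 X)"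
  then show "f \<otimes>\<^bsub>C2 X\<^esub> k \<otimes>\<^bsub>C2 X\<^esub> l = f \<otimes>\<^bsub>C2 X\<^esub> (k \<otimes>\<^bsub>C2 X\<^esub> l)"
    using C2_closed[of l X] by (auto simp: C2_def fun_eq_iff restrict_def)
next
  fix f assume f: "f \<in> carrier (C2 X)"
  then show "\<one>\<^bsub>C2 X\<^esub> \<otimes>\<^bsub>C2 X\<^esub> f = f"
    using C2_closed[OF f] by (auto simp: C2_def fun_eq_iff restrict_def extensional_def)
  show "f \<otimes>\<^bsub>C2 X\<^esub> \<one>\<^bsub>C2 X\<^esub> = f"
    using f by (auto simp: C2_def fun_eq_iff restrict_def extensional_def)
qed

lemma group_H2: "group (H2 X)"
  unfolding H2_def by (rule monoid.units_group[OF monoid_C2])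

end

theory Submission
  imports Defs
begin

text \<open>
  For fixed \<open>x\<close>, an invertible operation \<open>f\<close> gives a bijection \<open>f (x, \<cdot>)\<close> of the space,
  and the inverse in the group of invertible operations is the inverse of this bijection for every
  \<open>x\<close>. Distributivity of \<open>(g, h)\<close> says that each \<open>g (x, \<cdot>)\<close> is an endomorphism of the
  magma with multiplication \<open>h\<close>. A bijective endomorphism has an inverse that is again an
  endomorphism, which gives \<open>(g\<inverse>, h)\<close>; and an endomorphism of \<open>h\<close> preserves left
  division by \<open>h\<close>, which is \<open>h\<inverse>\<close>, and this gives \<open>(g, h\<inverse>)\<close>. The remaining pair
  comes from using both facts in turn.
\<close>

lemma H2_closed:
  assumes "f \<in> carrier (H2 X)" "x \<in> topspace X" "y \<in> topspace X"
  shows "f (x, y) \<in> topspace X"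
  using assms C2_closed[of f X] by (simp add: H2_def units_of_def Units_def)

lemma H2_inv_closed:
  assumes "f \<in> carrier (H2 X)"
  shows "inv\<^bsub>H2 X\<^esub> f \<in> carrier (H2 X)"
  using group.inv_closed[OF group_H2 assms] .

text \<open>
  These are the group laws evaluated at the point \<open>(x, y)\<close>: the product composes second
  arguments over a common first argument, so the inverse is the inverse of \<open>f (x, \<cdot>)\<close>
  fibrewise.
\<close>

lemma H2_inv_cancel:
  assumes f: "f \<in> carrier (H2 X)" and xy: "x \<in> topspace X" "y \<in> topspace X"
  shows "(inv\<^bsub>H2 X\<^esub> f) (x, f (x, y)) = y" and "f (x, (inv\<^bsub>H2 X\<^esub> f) (x, y)) = y"
proof -
  have "(inv\<^bsub>H2 X\<^esub> f \<otimes>\<^bsub>H2 X\<^esub> f) (x, y) = \<one>\<^bsub>H2 X\<^esub> (x, y)"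
    using group.l_inv[OF group_H2 f] by simp
  then show "(inv\<^bsub>H2 X\<^esub> f) (x, f (x, y)) = y"
    using xy by (simp add: H2_def units_of_def C2_def)
  have "(f \<otimes>\<^bsub>H2 X\<^esub> inv\<^bsub>H2 X\<^esub> f) (x, y) = \<one>\<^bsub>H2 X\<^esub> (x, y)"
    using group.r_inv[OF group_H2 f] by simp
  then show "f (x, (inv\<^bsub>H2 X\<^esub> f) (x, y)) = y"
    using xy by (simp add: H2_def units_of_def C2_def)
qed

text \<open>
  The value \<open>h\<inverse> (y, z)\<close> is the unique solution \<open>w\<close> of \<open>h (y, w) = z\<close>, and the
  endomorphism \<open>g (x, \<cdot>)\<close> maps it to the solution of the transported equation.
\<close>

lemma distributive_pair_inv_right:
  assumes "distributive_pair X g h"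
  shows "distributive_pair X g (inv\<^bsub>H2 X\<^esub> h)"
proof -
  let ?k = "inv\<^bsub>H2 X\<^esub> h"
  have g: "g \<in> carrier (H2 X)" and h: "h \<in> carrier (H2 X)"
    and dist: "\<And>x y z. \<lbrakk>x \<in> topspace X; y \<in> topspace X; z \<in> topspace X\<rbrakk>
      \<Longrightarrow> g (x, h (y, z)) = h (g (x, y), g (x, z))"
    using assms by (auto simp: distributive_pair_def)
  have k: "?k \<in> carrier (H2 X)"
    by (rule H2_inv_closed[OF h])
  have "g (x, ?k (y, z)) = ?k (g (x, y), g (x, z))"
    if xyz: "x \<in> topspace X" "y \<in> topspace X" "z \<in> topspace X" for x y z
  proof -
    have w: "?k (y, z) \<in> topspace X"
      using H2_closed[OF k] xyz by blast
    have "h (g (x, y), g (x, ?k (y, z))) = g (x, h (y, ?k (y, z)))"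
      using dist[OF xyz(1,2) w] by simp
    also have "\<dots> = g (x, z)"
      using H2_inv_cancel(2)[OF h xyz(2,3)] by simp
    finally show ?thesis
      using H2_inv_cancel(1)[OF h H2_closed[OF g xyz(1,2)] H2_closed[OF g xyz(1) w]] by simp
  qed
  then show ?thesis
    using g k by (simp add: distributive_pair_def)
qed

text \<open>
  The inverse of the bijective endomorphism \<open>g (x, \<cdot>)\<close> is an endomorphism: pull \<open>y\<close> and
  \<open>z\<close> back along it, multiply there, and compare the images.
\<close>

lemma distributive_pair_inv_left:
  assumes "distributive_pair X g h"
  shows "distributive_pair X (inv\<^bsub>H2 X\<^esub> g) h"
proof -
  let ?k = "inv\<^bsub>H2 X\<^esub> g"
  have g: "g \<in> carrier (H2 X)" and h: "h \<in> carrier (H2 X)"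
    and dist: "\<And>x y z. \<lbrakk>x \<in> topspace X; y \<in> topspace X; z \<in> topspace X\<rbrakk>
      \<Longrightarrow> g (x, h (y, z)) = h (g (x, y), g (x, z))"
    using assms by (auto simp: distributive_pair_def)
  have k: "?k \<in> carrier (H2 X)"
    by (rule H2_inv_closed[OF g])
  have "?k (x, h (y, z)) = h (?k (x, y), ?k (x, z))"
    if xyz: "x \<in> topspace X" "y \<in> topspace X" "z \<in> topspace X" for x y z
  proof -
    have y': "?k (x, y) \<in> topspace X" and z': "?k (x, z) \<in> topspace X"
      using H2_closed[OF k] xyz by blast+
    have "g (x, h (?k (x, y), ?k (x, z))) = h (y, z)"
      using dist[OF xyz(1) y' z'] H2_inv_cancel(2)[OF g xyz(1)] xyz by simp
    then show ?thesis
      using H2_inv_cancel(1)[OF g xyz(1) H2_closed[OF h y' z']] by simp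
  qed
  then show ?thesis
    using h k by (simp add: distributive_pair_def)
qed

theorem proposition3p2:
  fixes X :: "'a topology" and g h :: "'a \<times> 'a \<Rightarrow> 'a"
  assumes "g \<in> carrier (H2 X)" and "h \<in> carrier (H2 X)"
    and "distributive_pair X g h"
  shows "distributive_pair X g (inv\<^bsub>H2 X\<^esub> h)
    \<and> distributive_pair X (inv\<^bsub>H2 X\<^esub> g) h
    \<and> distributive_pair X (inv\<^bsub>H2 X\<^esub> g) (inv\<^bsub>H2 X\<^esub> h)"
  using assms(3) by (blast intro: distributive_pair_inv_right distributive_pair_inv_left)

end
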